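(* The class of commutative idempotent ordered monoids has the strong amalgamation property.
   Context: An ordered monoid is an algebra $\langle M,\wedge,\vee,\cdot,e\rangle$ (equivalently a structure $\langle M,\cdot,e,\le\rangle$), where $\langle M,\cdot,e\rangle$ is a monoid and $\wedge,\vee$ are the minimum and maximum of a total order $\le$ such that $a\le b$ implies $cad\le cbd$ for all $a,b,c,d$. It is idempotent if $a\cdot a=a$ for all $a$, and commutative if its product is commutative. Homomorphisms are order-preserving monoid homomorphisms; embeddings are injective homomorphisms. A class $\mathsf{K}$ has the strong amalgamation property if for all $\mathbf{A},\mathbf{B},\mathbf{C}\in\mathsf{K}$ and embeddings $i_1\colon\mathbf{A}\hookrightarrow\mathbf{B}$, $i_2\colon\mathbf{A}\hookrightarrow\mathbf{C}$ there exist $\mathbf{D}\in\mathsf{K}$ and embeddings $j_1\colon\mathbf{B}\hookrightarrow\mathbf{D}$, $j_2\colon\mathbf{C}\hookrightarrow\mathbf{D}$ such that $j_1\circ i_1=j_2\circ i_2$ and $j_1[B]\cap j_2[C]=(j_1\circ i_1)[A]$. *)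

theory Defs
  imports "HOL-Algebra.Group"
begin

record 'a ordered_monoid = "'a monoid" +
  leq :: "'a rel"

text \<open>The lattice operations of an ordered monoid are the minimum and maximum of its
  total order, so the structure is presented by its monoid reduct and that order.
  The predicate \<^const>\<open>linear_order_on\<close> also forces the relation to lie within the carrier.\<close>

locale ordered_monoid = monoid M for M :: "'a ordered_monoid" (structure) +
  assumes linear_order: "linear_order_on (carrier M) (leq M)"
    and compatible:
      "\<lbrakk>a \<in> carrier M; b \<in> carrier M; c \<in> carrier M; d \<in> carrier M; (a, b) \<in> leq M\<rbrakk>
        \<Longrightarrow> (c \<otimes> a \<otimes> d, c \<otimes> b \<otimes> d) \<in> leq M"

locale idempotent_ordered_monoid = ordered_monoid +
  assumes idempotent: "a \<in> carrier M \<Longrightarrow> a \<otimes> a = a"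

locale commutative_idempotent_ordered_monoid = idempotent_ordered_monoid + comm_monoid M

definition ordered_monoid_hom :: "'a ordered_monoid \<Rightarrow> 'b ordered_monoid \<Rightarrow> ('a \<Rightarrow> 'b) set"
  where "ordered_monoid_hom A B =
    {f \<in> hom A B. f \<one>\<^bsub>A\<^esub> = \<one>\<^bsub>B\<^esub> \<and> (\<forall>x y. (x, y) \<in> leq A \<longrightarrow> (f x, f y) \<in> leq B)}"

definition ordered_monoid_embedding :: "'a ordered_monoid \<Rightarrow> 'b ordered_monoid \<Rightarrow> ('a \<Rightarrow> 'b) set"
  where "ordered_monoid_embedding A B = {f \<in> ordered_monoid_hom A B. inj_on f (carrier A)}"

text \<open>A class of ordered monoids contains structures on arbitrary underlying sets, whereas
  a HOL predicate received as an argument has a single type. The strong amalgamation property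
  therefore takes one instance of the class for each of the four algebras involved; the
  instances are meant to be those of one polymorphic predicate.\<close>

definition strong_amalgamation_property ::
  "('a ordered_monoid \<Rightarrow> bool) \<Rightarrow> ('b ordered_monoid \<Rightarrow> bool) \<Rightarrow>
   ('c ordered_monoid \<Rightarrow> bool) \<Rightarrow> ('d ordered_monoid \<Rightarrow> bool) \<Rightarrow> bool"
  where "strong_amalgamation_property KA KB KC KD \<longleftrightarrow>
    (\<forall>A B C i1 i2.
      KA A \<and> KB B \<and> KC C \<and>
      i1 \<in> ordered_monoid_embedding A B \<and> i2 \<in> ordered_monoid_embedding A C \<longrightarrow>
      (\<exists>D j1 j2.
        KD D \<and>
        j1 \<in> ordered_monoid_embedding B D \<and> j2 \<in> ordered_monoid_embedding C D \<and>
        (\<forall>a \<in> carrier A. (j1 \<circ> i1) a = (j2 \<circ> i2) a) \<and>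
        j1 ` carrier B \<inter> j2 ` carrier C = (j1 \<circ> i1) ` carrier A))"

text \<open>HOL cannot quantify existentially over the type of the amalgam, so a type has to be
  named. For commutative idempotent ordered monoids with underlying types \<^typ>\<open>'b\<close> and
  \<^typ>\<open>'c\<close>, the sum type \<^typ>\<open>'b + 'c\<close> loses no generality: a product of two elements
  of an idempotent ordered monoid is always one of its two factors when these commute, so in
  any amalgam the union of the two images is itself a subalgebra that amalgamates.\<close>

end

theory Submission
  imports Defs
begin

text \<open>A commutative idempotent ordered monoid is nothing but a chain with a greatest element in
which every element carries a sign, and chains amalgamate strongly.

The product of two elements is always one of them (\<open>product_is_factor\<close>), so the
semilattice order of the monoid, in which \<open>x\<close> is below \<open>y\<close> when \<open>x y = x\<close>, is total, and the
unit is its greatest element. Call it the natural order. Compatibility of the product with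
\<open>\<le>\<close> makes the comparison of \<open>x\<close> with the unit decide the comparison of \<open>x\<close> with everything
naturally above it: if \<open>x \<le> e\<close> and \<open>x y = x\<close>, then \<open>x = x y \<le> e y = y\<close>, and dually if
\<open>e \<le> x\<close>. So \<open>\<le>\<close> is recovered from the natural order and the set of negative elements, those
below the unit (\<open>leq_iff_signed\<close>). Conversely, every signed chain with a greatest element is
such a monoid (\<open>signed_chain_monoid_commutative_idempotent\<close>), and a map that preserves
natural order, sign and unit is a homomorphism; injectivity makes it an embedding
(\<open>embedding_into_signed_chain\<close>).

Given chains \<open>B\<close> and \<open>C\<close> over a common subchain \<open>A\<close>, put \<open>c\<close> below \<open>b\<close> exactly when some
\<open>a\<close> of \<open>A\<close> lies between them, and otherwise put \<open>b\<close> below \<open>c\<close> (\<open>linear_order_on_cut_sum\<close>). The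
elements of \<open>C\<close> that come from \<open>A\<close> are identified with their copies in \<open>B\<close> by leaving them
out of the carrier. All elements keep their sign, which is consistent on \<open>A\<close> since
embeddings reflect \<open>\<le>\<close>, and nothing beyond \<open>A\<close> is shared, so the amalgam is strong.\<close>

section \<open>Linear orders on a set\<close>

lemma linear_order_onD:
  assumes "linear_order_on S r"
  shows linear_order_on_carrier: "r \<subseteq> S \<times> S"
    and linear_order_on_trans: "\<lbrakk>(x, y) \<in> r; (y, z) \<in> r\<rbrakk> \<Longrightarrow> (x, z) \<in> r"
    and linear_order_on_antisym: "\<lbrakk>(x, y) \<in> r; (y, x) \<in> r\<rbrakk> \<Longrightarrow> x = y"
    and linear_order_on_comparable: "\<lbrakk>x \<in> S; y \<in> S\<rbrakk> \<Longrightarrow> (x, y) \<in> r \<or> (y, x) \<in> r"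
proof -
  have r: "r \<subseteq> S \<times> S" "refl_on S r" "trans r" "antisym r" "total_on S r"
    using assms by (simp_all add: order_on_defs)
  show "r \<subseteq> S \<times> S" by (fact r(1))
  show "\<lbrakk>(x, y) \<in> r; (y, z) \<in> r\<rbrakk> \<Longrightarrow> (x, z) \<in> r" using r(3) by (rule transD)
  show "\<lbrakk>(x, y) \<in> r; (y, x) \<in> r\<rbrakk> \<Longrightarrow> x = y" using r(4) by (rule antisymD)
  show "\<lbrakk>x \<in> S; y \<in> S\<rbrakk> \<Longrightarrow> (x, y) \<in> r \<or> (y, x) \<in> r"
    using r(2,5) unfolding refl_on_def total_on_def by (cases "x = y") blast+
qed

lemma linear_order_onI:
  assumes "r \<subseteq> S \<times> S"
    and "\<And>x y z. \<lbrakk>(x, y) \<in> r; (y, z) \<in> r\<rbrakk> \<Longrightarrow> (x, z) \<in> r"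
    and "\<And>x y. \<lbrakk>(x, y) \<in> r; (y, x) \<in> r\<rbrakk> \<Longrightarrow> x = y"
    and "\<And>x y. \<lbrakk>x \<in> S; y \<in> S\<rbrakk> \<Longrightarrow> (x, y) \<in> r \<or> (y, x) \<in> r"
  shows "linear_order_on S r"
  unfolding order_on_defs refl_on_def total_on_def trans_def antisym_def
  using assms by blast

lemma linear_order_on_Field: "linear_order_on S r \<Longrightarrow> Field r = S"
  using linear_order_on_carrier[of S r] linear_order_on_comparable[of S r]
  by (fastforce simp: Field_def)

lemma linear_order_on_subset:
  assumes "linear_order_on A r" "B \<subseteq> A"
  shows "linear_order_on B (Restr r B)"
  using assms unfolding order_on_defs refl_on_def total_on_def trans_def antisym_def by blast

section \<open>Signed chains\<close>

text \<open>The product is the minimum for \<open>r\<close>. A member of \<open>N\<close> is a negative element and lies below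
everything that \<open>r\<close> puts above it; any other element lies above all of that.\<close>

definition signed_chain_monoid ::
  "'a set \<Rightarrow> 'a rel \<Rightarrow> 'a set \<Rightarrow> 'a \<Rightarrow> 'a ordered_monoid"
  where "signed_chain_monoid S r N t =
    \<lparr>carrier = S, mult = (\<lambda>x y. if (x, y) \<in> r then x else y), one = t,
     leq = {(x, y). (x, y) \<in> r \<and> x \<in> N \<or> (y, x) \<in> r \<and> y \<notin> N}\<rparr>"

lemma linear_order_on_signed:
  assumes "linear_order_on S r"
  shows "linear_order_on S {(x, y). (x, y) \<in> r \<and> x \<in> N \<or> (y, x) \<in> r \<and> y \<notin> N}"
    (is "linear_order_on S ?q")
proof (rule linear_order_onI)
  note r = linear_order_onD[OF assms]
  show "?q \<subseteq> S \<times> S" using r(1) by auto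
  show "(x, z) \<in> ?q" if "(x, y) \<in> ?q" "(y, z) \<in> ?q" for x y z
  proof -
    have "x \<in> S" "z \<in> S" using that r(1) by auto
    then show ?thesis using that r(4)[of x z] r(2) by blast
  qed
  show "x = y" if "(x, y) \<in> ?q" "(y, x) \<in> ?q" for x y
    using that r(3) by auto
  show "(x, y) \<in> ?q \<or> (y, x) \<in> ?q" if "x \<in> S" "y \<in> S" for x y
    using that r(4) by auto
qed

text \<open>Multiplication by \<open>c\<close> fixes what \<open>r\<close> puts below \<open>c\<close> and moves the rest to \<open>c\<close>. It is monotone
because, when \<open>c\<close> separates \<open>a\<close> from \<open>b\<close> in the chain, the lower of the two lies on the same
side of \<open>c\<close> as of the other, its sign being all that matters.\<close>

proposition signed_chain_monoid_commutative_idempotent: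
  assumes lin: "linear_order_on S r" and top: "t \<in> S" "\<And>x. x \<in> S \<Longrightarrow> (x, t) \<in> r"
  shows "commutative_idempotent_ordered_monoid (signed_chain_monoid S r N t)"
    (is "commutative_idempotent_ordered_monoid ?M")
proof -
  note comparable = linear_order_on_comparable[OF lin]
    and tr = linear_order_on_trans[OF lin]
    and as = linear_order_on_antisym[OF lin]
  have M: "comm_monoid ?M"
  proof (rule comm_monoidI)
    show "x \<otimes>\<^bsub>?M\<^esub> y \<in> carrier ?M" if "x \<in> carrier ?M" "y \<in> carrier ?M" for x y
      using that by (simp add: signed_chain_monoid_def)
    show "\<one>\<^bsub>?M\<^esub> \<in> carrier ?M"
      using top(1) by (simp add: signed_chain_monoid_def)
    show "x \<otimes>\<^bsub>?M\<^esub> y \<otimes>\<^bsub>?M\<^esub> z = x \<otimes>\<^bsub>?M\<^esub> (y \<otimes>\<^bsub>?M\<^esub> z)"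
      if "x \<in> carrier ?M" "y \<in> carrier ?M" "z \<in> carrier ?M" for x y z
      using that comparable[of x y] comparable[of y z] comparable[of x z]
        tr[of x y z] tr[of z y x] as[of x z] tr[of x z y]
      by (auto simp: signed_chain_monoid_def)
    show "\<one>\<^bsub>?M\<^esub> \<otimes>\<^bsub>?M\<^esub> x = x" if "x \<in> carrier ?M" for x
      using that top as[of x t] by (auto simp: signed_chain_monoid_def)
    show "x \<otimes>\<^bsub>?M\<^esub> y = y \<otimes>\<^bsub>?M\<^esub> x" if "x \<in> carrier ?M" "y \<in> carrier ?M" for x y
      using that comparable[of x y] as[of x y] by (auto simp: signed_chain_monoid_def)
  qed
  interpret M: comm_monoid ?M by (fact M)
  have mono: "(c \<otimes>\<^bsub>?M\<^esub> a, c \<otimes>\<^bsub>?M\<^esub> b) \<in> leq ?M"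
    if "a \<in> S" "b \<in> S" "c \<in> S" "(a, b) \<in> leq ?M" for a b c
    using that comparable[of a c] comparable[of b c] comparable[of c c] tr[of a c b] tr[of b c a] as[of a b]
    by (auto simp: signed_chain_monoid_def)
  show ?thesis
  proof unfold_locales
    show "linear_order_on (carrier ?M) (leq ?M)"
      using linear_order_on_signed[OF lin] by (simp add: signed_chain_monoid_def)
    show "(c \<otimes>\<^bsub>?M\<^esub> a \<otimes>\<^bsub>?M\<^esub> d, c \<otimes>\<^bsub>?M\<^esub> b \<otimes>\<^bsub>?M\<^esub> d) \<in> leq ?M"
      if "a \<in> carrier ?M" "b \<in> carrier ?M" "c \<in> carrier ?M" "d \<in> carrier ?M" "(a, b) \<in> leq ?M"
      for a b c d
    \<comment> \<open>Commutativity turns a two-sided translation into a one-sided one.\<close>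
    proof -
      have "c \<otimes>\<^bsub>?M\<^esub> x \<otimes>\<^bsub>?M\<^esub> d = (c \<otimes>\<^bsub>?M\<^esub> d) \<otimes>\<^bsub>?M\<^esub> x" if "x \<in> carrier ?M" for x
        using that \<open>c \<in> carrier ?M\<close> \<open>d \<in> carrier ?M\<close> by (simp add: M.m_ac)
      moreover have "c \<otimes>\<^bsub>?M\<^esub> d \<in> S" "a \<in> S" "b \<in> S"
        using that by (simp_all add: signed_chain_monoid_def)
      ultimately show ?thesis
        using mono[of a b "c \<otimes>\<^bsub>?M\<^esub> d"] that by simp
    qed
    show "a \<otimes>\<^bsub>?M\<^esub> a = a" if "a \<in> carrier ?M" for a
      by (simp add: signed_chain_monoid_def)
  qed
qed

text \<open>The usual order of a meet semilattice. It is a different order from \<open>\<le>\<close>: the unit is its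
greatest element, whereas elements of the monoid may lie on both sides of the unit.\<close>

definition natural_order :: "('a, 'm) monoid_scheme \<Rightarrow> 'a rel"
  where "natural_order M = {(x, y). x \<in> carrier M \<and> y \<in> carrier M \<and> x \<otimes>\<^bsub>M\<^esub> y = x}"

context commutative_idempotent_ordered_monoid
begin

lemma leq_carrier: "(x, y) \<in> leq M \<Longrightarrow> x \<in> carrier M \<and> y \<in> carrier M"
  using linear_order_on_carrier[OF linear_order] by blast

lemmas leq_total = linear_order_on_comparable[OF linear_order]
  and leq_antisym = linear_order_on_antisym[OF linear_order]

lemma mult_mono:
  assumes "c \<in> carrier M" "(a, b) \<in> leq M"
  shows "(c \<otimes> a, c \<otimes> b) \<in> leq M"
  using compatible[of a b c \<one>] leq_carrier[of a b] assms by auto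

text \<open>For \<open>a \<le> b\<close>, idempotence squeezes \<open>a b\<close> between \<open>a\<close> and \<open>b\<close>. Both factors absorb into
\<open>a b\<close>, so comparing \<open>a b\<close> with the unit and multiplying by a factor collapses one half of
the interval: by \<open>b\<close> if \<open>a b\<close> is above the unit, by \<open>a\<close> if it is below.\<close>

lemma product_is_factor:
  assumes x: "x \<in> carrier M" and y: "y \<in> carrier M"
  shows "x \<otimes> y = x \<or> x \<otimes> y = y"
proof -
  have *: "a \<otimes> b = a \<or> a \<otimes> b = b" if ab: "(a, b) \<in> leq M" for a b
  proof -
    have [simp]: "a \<in> carrier M" "b \<in> carrier M" using leq_carrier[OF ab] by auto
    have aab: "a \<otimes> (a \<otimes> b) = a \<otimes> b"
      by (simp add: m_assoc[symmetric] idempotent)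
    have bab: "b \<otimes> (a \<otimes> b) = a \<otimes> b"
      by (simp add: m_lcomm[of b a b] idempotent)
    have lower: "(a, a \<otimes> b) \<in> leq M"
      using mult_mono[of a a b] ab by (simp add: idempotent)
    have upper: "(a \<otimes> b, b) \<in> leq M"
      using mult_mono[of b a b] ab by (simp add: idempotent m_comm)
    consider "(\<one>, a \<otimes> b) \<in> leq M" | "(a \<otimes> b, \<one>) \<in> leq M"
      using leq_total[of \<one> "a \<otimes> b"] by auto
    then show ?thesis
    proof cases
      case 1
      then have "(b, a \<otimes> b) \<in> leq M" using mult_mono[of b \<one> "a \<otimes> b"] by (simp add: bab)
      then show ?thesis using upper leq_antisym by blast
    next
      case 2
      then have "(a \<otimes> b, a) \<in> leq M" using mult_mono[of a "a \<otimes> b" \<one>] by (simp add: aab)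
      then show ?thesis using lower leq_antisym by blast
    qed
  qed
  show ?thesis
    using leq_total[OF x y] *[of x y] *[of y x] m_comm[OF x y] by auto
qed

lemma linear_order_natural: "linear_order_on (carrier M) (natural_order M)"
proof (rule linear_order_onI)
  show "natural_order M \<subseteq> carrier M \<times> carrier M"
    by (auto simp: natural_order_def)
  show "(x, z) \<in> natural_order M" if "(x, y) \<in> natural_order M" "(y, z) \<in> natural_order M" for x y z
    using that m_assoc[of x y z] by (auto simp: natural_order_def)
  show "x = y" if "(x, y) \<in> natural_order M" "(y, x) \<in> natural_order M" for x y
    using that by (auto simp: natural_order_def m_comm)
  show "(x, y) \<in> natural_order M \<or> (y, x) \<in> natural_order M"
    if "x \<in> carrier M" "y \<in> carrier M" for x y
    using that product_is_factor[of x y] by (auto simp: natural_order_def m_comm)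
qed

text \<open>Multiplying \<open>x \<le> e\<close> or \<open>e \<le> x\<close> by an element \<open>y\<close> naturally above \<open>x\<close> leaves \<open>x\<close> unchanged and
replaces \<open>e\<close> by \<open>y\<close>. As the natural order is total, this decides every comparison.\<close>

lemma leq_iff_signed:
  "(x, y) \<in> leq M \<longleftrightarrow>
    (x, y) \<in> natural_order M \<and> (x, \<one>) \<in> leq M \<or> (y, x) \<in> natural_order M \<and> (y, \<one>) \<notin> leq M"
proof -
  have below: "(u, v) \<in> leq M" if "(u, v) \<in> natural_order M" "(u, \<one>) \<in> leq M" for u v
    using mult_mono[of v u \<one>] that by (auto simp: natural_order_def m_comm)
  have above: "(v, u) \<in> leq M" if "(u, v) \<in> natural_order M" "(u, \<one>) \<notin> leq M" for u v
    using mult_mono[of v \<one> u] leq_total[of u \<one>] that by (auto simp: natural_order_def m_comm)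
  have "(x, y) \<in> natural_order M \<or> (y, x) \<in> natural_order M" if "(x, y) \<in> leq M"
    using product_is_factor[of x y] leq_carrier[OF that] by (auto simp: natural_order_def m_comm)
  moreover have "(x, x) \<in> natural_order M" if "(x, y) \<in> leq M"
    using leq_carrier[OF that] by (simp add: natural_order_def idempotent)
  ultimately show ?thesis
    using below above leq_antisym by metis
qed

text \<open>Both chains are total, so preserving the natural order already forces minima, that is
products, to be preserved. As the signs agree, \<open>\<le>\<close> is preserved by \<open>leq_iff_signed\<close>.\<close>

proposition embedding_into_signed_chain:
  assumes lin: "linear_order_on S r"
    and inj: "inj_on f (carrier M)" and f: "f ` carrier M \<subseteq> S" and one: "f \<one> = t"
    and order: "\<And>x y. (x, y) \<in> natural_order M \<Longrightarrow> (f x, f y) \<in> r"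
    and sign: "\<And>x. x \<in> carrier M \<Longrightarrow> f x \<in> N \<longleftrightarrow> (x, \<one>) \<in> leq M"
  shows "f \<in> ordered_monoid_embedding M (signed_chain_monoid S r N t)"
proof -
  note as = linear_order_on_antisym[OF lin]
  have "f (x \<otimes> y) = (if (f x, f y) \<in> r then f x else f y)"
    if [simp]: "x \<in> carrier M" "y \<in> carrier M" for x y
  proof (cases "(x, y) \<in> natural_order M")
    case True
    then show ?thesis using order[OF True] by (simp add: natural_order_def)
  next
    case False
    then have xy: "x \<otimes> y = y" using product_is_factor[of x y] by (auto simp: natural_order_def)
    then have "(f y, f x) \<in> r" by (intro order) (simp add: natural_order_def m_comm)
    then show ?thesis using as xy by auto
  qed
  moreover have "(f x, f y) \<in> r \<and> f x \<in> N \<or> (f y, f x) \<in> r \<and> f y \<notin> N" if "(x, y) \<in> leq M" for x y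
    using that leq_carrier[OF that] order sign by (subst (asm) leq_iff_signed) blast
  ultimately show ?thesis
    using inj f one
    by (auto simp: ordered_monoid_embedding_def ordered_monoid_hom_def hom_def signed_chain_monoid_def)
qed

end

text \<open>This is what makes the two orders and the signs that \<open>A\<close> inherits from \<open>B\<close> and from \<open>C\<close>
agree.\<close>

lemma embedding_reflects:
  assumes A: "commutative_idempotent_ordered_monoid A"
    and B: "commutative_idempotent_ordered_monoid B"
    and i: "i \<in> ordered_monoid_embedding A B"
    and x: "x \<in> carrier A" and y: "y \<in> carrier A"
  shows natural_order_embedding: "(i x, i y) \<in> natural_order B \<longleftrightarrow> (x, y) \<in> natural_order A"
    and leq_embedding: "(i x, i y) \<in> leq B \<longleftrightarrow> (x, y) \<in> leq A"
proof -
  interpret A: commutative_idempotent_ordered_monoid A by (fact A)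
  interpret B: commutative_idempotent_ordered_monoid B by (fact B)
  have i': "i \<in> hom A B" "inj_on i (carrier A)" "\<And>u v. (u, v) \<in> leq A \<Longrightarrow> (i u, i v) \<in> leq B"
    using i by (auto simp: ordered_monoid_embedding_def ordered_monoid_hom_def)
  show "(i x, i y) \<in> natural_order B \<longleftrightarrow> (x, y) \<in> natural_order A"
    using x y i' by (auto simp: natural_order_def hom_mult[symmetric] hom_in_carrier inj_on_eq_iff)
  show "(i x, i y) \<in> leq B \<longleftrightarrow> (x, y) \<in> leq A"
    using x y i'(2,3) A.leq_total[OF x y] B.leq_antisym[of "i x" "i y"] by (auto dest: inj_onD)
qed

section \<open>Gluing chains\<close>

text \<open>A relation \<open>R\<close> saying which right elements are below which left ones determines the whole
comparison between the two sides of the disjoint sum, by totality. Membership in the fields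
is asked for only where a negated condition would otherwise let in elements outside the
two chains.\<close>

definition cut_sum :: "'b rel \<Rightarrow> 'c rel \<Rightarrow> ('c \<times> 'b) set \<Rightarrow> ('b + 'c) rel"
  where "cut_sum r s R =
    {(u, v). case (u, v) of
        (Inl b, Inl b') \<Rightarrow> (b, b') \<in> r
      | (Inr c, Inr c') \<Rightarrow> (c, c') \<in> s
      | (Inr c, Inl b) \<Rightarrow> (c, b) \<in> R
      | (Inl b, Inr c) \<Rightarrow> b \<in> Field r \<and> c \<in> Field s \<and> (c, b) \<notin> R}"

lemma in_cut_sum [simp]:
  "(Inl b, Inl b') \<in> cut_sum r s R \<longleftrightarrow> (b, b') \<in> r"
  "(Inr c, Inr c') \<in> cut_sum r s R \<longleftrightarrow> (c, c') \<in> s"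
  "(Inr c, Inl b) \<in> cut_sum r s R \<longleftrightarrow> (c, b) \<in> R"
  "(Inl b, Inr c) \<in> cut_sum r s R \<longleftrightarrow> b \<in> Field r \<and> c \<in> Field s \<and> (c, b) \<notin> R"
  by (simp_all add: cut_sum_def)

text \<open>Closure of \<open>R\<close> downwards on the right and upwards on the left means that each left element
cuts the right chain into a lower and an upper part, and that these cuts grow with the
element. Transitivity is the monotonicity of the cuts: two elements on one side that are
separated by an element of the other side cannot be in the opposite order.\<close>

lemma linear_order_on_cut_sum:
  assumes lin: "linear_order_on B r" "linear_order_on C s"
    and R: "R \<subseteq> C \<times> B" and cut: "s O R O r \<subseteq> R"
  shows "linear_order_on (B <+> C) (cut_sum r s R)"
proof (rule linear_order_onI)
  note r = linear_order_onD[OF lin(1)] and s = linear_order_onD[OF lin(2)]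
  note F = linear_order_on_Field[OF lin(1)] linear_order_on_Field[OF lin(2)]
  have down: "(c, b) \<in> R" if "(c, c') \<in> s" "(c', b) \<in> R" for b c c'
    using that cut R r(4)[of b b] by blast
  have up: "(c, b) \<in> R" if "(c, b') \<in> R" "(b', b) \<in> r" for b b' c
    using that cut R s(4)[of c c] by blast
  let ?t = "cut_sum r s R"
  show sub: "?t \<subseteq> (B <+> C) \<times> (B <+> C)"
  proof (rule subrelI)
    show "(u, v) \<in> (B <+> C) \<times> (B <+> C)" if "(u, v) \<in> ?t" for u v
      using that r(1) s(1) R F by (cases u; cases v) auto
  qed
  show "(u, w) \<in> ?t" if uv: "(u, v) \<in> ?t" and vw: "(v, w) \<in> ?t" for u v w
  proof -
    have mem: "u \<in> B <+> C" "v \<in> B <+> C" "w \<in> B <+> C" using sub uv vw by auto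
    show ?thesis
    proof (cases u; cases w)
      fix b b' assume "u = Inl b" "w = Inl b'"
      then show ?thesis
        using uv vw mem r(2) r(4)[of b b'] up by (cases v) auto
    next
      fix b c assume "u = Inl b" "w = Inr c"
      then show ?thesis
        using uv vw mem F up down by (cases v) auto
    next
      fix c b assume "u = Inr c" "w = Inl b"
      then show ?thesis
        using uv vw up down by (cases v) auto
    next
      fix c c' assume "u = Inr c" "w = Inr c'"
      then show ?thesis
        using uv vw mem s(2) s(4)[of c c'] down by (cases v) auto
    qed
  qed
  show "u = v" if "(u, v) \<in> ?t" "(v, u) \<in> ?t" for u v
    using that r(3) s(3) by (cases u; cases v) auto
  show "(u, v) \<in> ?t \<or> (v, u) \<in> ?t" if "u \<in> B <+> C" "v \<in> B <+> C" for u v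
    using that r(4)[of "projl u" "projl v"] s(4)[of "projr u" "projr v"] F by auto
qed

section \<open>The amalgam\<close>

text \<open>The carrier consists of all of \<open>B\<close> and of the elements of \<open>C\<close> outside the image of \<open>A\<close>, so
that \<open>j\<close> is the inclusion and \<open>l\<close> sends the remaining elements of \<open>C\<close> to their
representatives in \<open>B\<close>.\<close>

lemma strong_amalgam_exists:
  fixes A :: "'a ordered_monoid" and B :: "'b ordered_monoid" and C :: "'c ordered_monoid"
  assumes A: "commutative_idempotent_ordered_monoid A"
    and B: "commutative_idempotent_ordered_monoid B"
    and C: "commutative_idempotent_ordered_monoid C"
    and i: "i \<in> ordered_monoid_embedding A B" and k: "k \<in> ordered_monoid_embedding A C"
  obtains D :: "('b + 'c) ordered_monoid" and j l where
    "commutative_idempotent_ordered_monoid D"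
    "j \<in> ordered_monoid_embedding B D" "l \<in> ordered_monoid_embedding C D"
    "\<And>a. a \<in> carrier A \<Longrightarrow> j (i a) = l (k a)"
    "j ` carrier B \<inter> l ` carrier C = (\<lambda>a. j (i a)) ` carrier A"
proof -
  interpret A: commutative_idempotent_ordered_monoid A by (fact A)
  interpret B: commutative_idempotent_ordered_monoid B by (fact B)
  interpret C: commutative_idempotent_ordered_monoid C by (fact C)
  have i': "i \<in> carrier A \<rightarrow> carrier B" "inj_on i (carrier A)" "i \<one>\<^bsub>A\<^esub> = \<one>\<^bsub>B\<^esub>"
    and k': "k \<in> carrier A \<rightarrow> carrier C" "inj_on k (carrier A)" "k \<one>\<^bsub>A\<^esub> = \<one>\<^bsub>C\<^esub>"
    using i k by (auto simp: ordered_monoid_embedding_def ordered_monoid_hom_def hom_def)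
  let ?r = "natural_order B" and ?s = "natural_order C"
  note lin_B = B.linear_order_natural and lin_C = C.linear_order_natural
  note r = linear_order_onD[OF lin_B] linear_order_on_Field[OF lin_B]
    and s = linear_order_onD[OF lin_C] linear_order_on_Field[OF lin_C]
  define R where "R = {(c, b). \<exists>a \<in> carrier A. (c, k a) \<in> ?s \<and> (i a, b) \<in> ?r}"
  define S where "S = Inl ` carrier B \<union> Inr ` (carrier C - k ` carrier A)"
  define t where "t = Restr (cut_sum ?r ?s R) S"
  define N where "N = Inl ` {b. (b, \<one>\<^bsub>B\<^esub>) \<in> leq B} \<union> Inr ` {c. (c, \<one>\<^bsub>C\<^esub>) \<in> leq C}"
  define D where "D = signed_chain_monoid S t N (Inl \<one>\<^bsub>B\<^esub>)"
  define j :: "'b \<Rightarrow> 'b + 'c" where "j = Inl"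
  define l where "l c = (if c \<in> k ` carrier A then Inl (i (inv_into (carrier A) k c)) else Inr c)" for c
  have l_k: "l (k a) = Inl (i a)" if "a \<in> carrier A" for a
    using that k'(2) by (simp add: l_def)
  have l_notin: "l c = Inr c" if "c \<notin> k ` carrier A" for c
    using that by (simp add: l_def)
  have lin: "linear_order_on S t"
    unfolding t_def
  proof (rule linear_order_on_subset)
    have "R \<subseteq> carrier C \<times> carrier B" using r(1) s(1) by (auto simp: R_def)
    moreover have "?s O R O ?r \<subseteq> R"
      using r(2) s(2) unfolding R_def by blast
    ultimately show "linear_order_on (carrier B <+> carrier C) (cut_sum ?r ?s R)"
      by (rule linear_order_on_cut_sum[OF lin_B lin_C])
    show "S \<subseteq> carrier B <+> carrier C" by (auto simp: S_def)
  qed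
  have one: "Inl \<one>\<^bsub>B\<^esub> \<in> S" by (simp add: S_def)
  have top: "(x, Inl \<one>\<^bsub>B\<^esub>) \<in> t" if "x \<in> S" for x
  proof -
    \<comment> \<open>The shared unit lies between the two elements.\<close>
    have "(c, \<one>\<^bsub>B\<^esub>) \<in> R" if "c \<in> carrier C" for c
      unfolding R_def using that i'(3) k'(3)
      by (auto simp: natural_order_def intro!: bexI[of _ "\<one>\<^bsub>A\<^esub>"])
    then show ?thesis using that one by (auto simp: t_def S_def natural_order_def)
  qed
  have D: "commutative_idempotent_ordered_monoid D"
    unfolding D_def using lin one top by (rule signed_chain_monoid_commutative_idempotent)
  have jemb: "j \<in> ordered_monoid_embedding B D"
    unfolding D_def
  proof (rule B.embedding_into_signed_chain[OF lin])
    show "(j x, j y) \<in> t" if "(x, y) \<in> ?r" for x y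
      using that r(1) by (auto simp: t_def S_def j_def)
  qed (auto simp: j_def S_def N_def)
  have lS: "l c \<in> S" if "c \<in> carrier C" for c
    using that i'(1) l_k by (cases "c \<in> k ` carrier A") (auto simp: S_def l_notin)
  have lemb: "l \<in> ordered_monoid_embedding C D"
    unfolding D_def
  proof (rule C.embedding_into_signed_chain[OF lin])
    show "inj_on l (carrier C)"
    proof (rule inj_onI)
      fix c c' assume "l c = l c'"
      then show "c = c'"
        using i'(2) l_k by (cases "c \<in> k ` carrier A"; cases "c' \<in> k ` carrier A")
          (auto simp: l_notin dest: inj_onD)
    qed
    show "l ` carrier C \<subseteq> S" using lS by auto
    show "l \<one>\<^bsub>C\<^esub> = Inl \<one>\<^bsub>B\<^esub>" using l_k[of "\<one>\<^bsub>A\<^esub>"] i'(3) k'(3) by simp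
    show "(l c, l c') \<in> t" if cc': "(c, c') \<in> ?s" for c c'
    proof -
      have mem: "c \<in> carrier C" "c' \<in> carrier C" using cc' s(1) by auto
      have "(l c, l c') \<in> cut_sum ?r ?s R"
      proof (cases "c \<in> k ` carrier A"; cases "c' \<in> k ` carrier A")
        assume "c \<in> k ` carrier A" "c' \<in> k ` carrier A"
        then show ?thesis
          using cc' natural_order_embedding[OF A B i] natural_order_embedding[OF A C k]
          by (auto simp: l_k)
      next
        assume "c \<in> k ` carrier A" and c': "c' \<notin> k ` carrier A"
        then obtain a where a: "a \<in> carrier A" "c = k a" by auto
        \<comment> \<open>An element of \<open>A\<close> between the two would force \<open>c'\<close> below \<open>c\<close>, hence equal to it,
          although only \<open>c\<close> comes from \<open>A\<close>.\<close>
        have "(c', i a) \<notin> R"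
        proof
          assume "(c', i a) \<in> R"
          then obtain a' where a': "a' \<in> carrier A" "(c', k a') \<in> ?s" "(i a', i a) \<in> ?r"
            by (auto simp: R_def)
          then have "(k a', k a) \<in> ?s"
            using a natural_order_embedding[OF A B i] natural_order_embedding[OF A C k] by blast
          then have "c' = c"
            using a a' cc' s(2,3) by metis
          then show False using a c' by auto
        qed
        then show ?thesis
          using a c' mem i'(1) r(5) s(5) by (auto simp: l_k l_notin)
      next
        assume c: "c \<notin> k ` carrier A" and "c' \<in> k ` carrier A"
        then obtain a where a: "a \<in> carrier A" "c' = k a" by auto
        \<comment> \<open>Here \<open>a\<close> itself witnesses \<open>R\<close>.\<close>
        moreover have "(i a, i a) \<in> ?r" using a i'(1) by (auto simp: natural_order_def intro!: B.idempotent)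
        ultimately show ?thesis
          using c cc' by (auto simp: l_k l_notin R_def)
      next
        assume "c \<notin> k ` carrier A" "c' \<notin> k ` carrier A"
        then show ?thesis using cc' by (simp add: l_notin)
      qed
      then show ?thesis using lS mem by (simp add: t_def)
    qed
    show "l c \<in> N \<longleftrightarrow> (c, \<one>\<^bsub>C\<^esub>) \<in> leq C" if "c \<in> carrier C" for c
    proof (cases "c \<in> k ` carrier A")
      case True
      then obtain a where a: "a \<in> carrier A" "c = k a" by auto
      then show ?thesis
        using leq_embedding[OF A B i a(1), of "\<one>\<^bsub>A\<^esub>"] leq_embedding[OF A C k a(1), of "\<one>\<^bsub>A\<^esub>"]
        by (auto simp: N_def l_k i'(3) k'(3))
    next
      case False
      then show ?thesis by (auto simp: N_def l_notin)
    qed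
  qed
  have "j (i a) = l (k a)" if "a \<in> carrier A" for a
    using that by (simp add: j_def l_k)
  moreover have "j ` carrier B \<inter> l ` carrier C = (\<lambda>a. j (i a)) ` carrier A"
  proof
    show "j ` carrier B \<inter> l ` carrier C \<subseteq> (\<lambda>a. j (i a)) ` carrier A"
      by (auto simp: j_def l_def split: if_splits intro: inv_into_into)
    show "(\<lambda>a. j (i a)) ` carrier A \<subseteq> j ` carrier B \<inter> l ` carrier C"
      using i'(1) k'(1) by (force simp: j_def l_k[symmetric])
  qed
  ultimately show thesis
    using that[OF D jemb lemb] by blast
qed

theorem corollary7p5:
  shows "strong_amalgamation_property
    (commutative_idempotent_ordered_monoid :: 'a ordered_monoid \<Rightarrow> bool)
    (commutative_idempotent_ordered_monoid :: 'b ordered_monoid \<Rightarrow> bool)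
    (commutative_idempotent_ordered_monoid :: 'c ordered_monoid \<Rightarrow> bool)
    (commutative_idempotent_ordered_monoid :: ('b + 'c) ordered_monoid \<Rightarrow> bool)"
  unfolding strong_amalgamation_property_def comp_def
proof (intro allI impI, elim conjE)
  fix A :: "'a ordered_monoid" and B :: "'b ordered_monoid" and C :: "'c ordered_monoid"
    and i k
  assume "commutative_idempotent_ordered_monoid A" "commutative_idempotent_ordered_monoid B"
    "commutative_idempotent_ordered_monoid C"
    "i \<in> ordered_monoid_embedding A B" "k \<in> ordered_monoid_embedding A C"
  from strong_amalgam_exists[OF this] obtain D :: "('b + 'c) ordered_monoid" and j l where
    "commutative_idempotent_ordered_monoid D"
    "j \<in> ordered_monoid_embedding B D" "l \<in> ordered_monoid_embedding C D"
    "\<And>a. a \<in> carrier A \<Longrightarrow> j (i a) = l (k a)"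
    "j ` carrier B \<inter> l ` carrier C = (\<lambda>a. j (i a)) ` carrier A"
    by metis
  then show "\<exists>(D :: ('b + 'c) ordered_monoid) j l. commutative_idempotent_ordered_monoid D \<and>
      j \<in> ordered_monoid_embedding B D \<and> l \<in> ordered_monoid_embedding C D \<and>
      (\<forall>a \<in> carrier A. j (i a) = l (k a)) \<and>
      j ` carrier B \<inter> l ` carrier C = (\<lambda>a. j (i a)) ` carrier A"
    by (intro exI conjI ballI)
qed

end
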